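(* Let $G$ be a connected graph with $m$ edges and let $v\in V(G)$. Let $k\ge 2$ and let $\widehat{G}$ be the graph obtained from $G$ by attaching $k$ pendent vertices to $v$. If \[m > \frac{k+1}{4},\] then the independent set formed by the $k$ new pendent vertices is a Braess clique of $\widehat{G}$; that is, if $\widetilde{G}$ is the graph obtained from $\widehat{G}$ by adding all edges between these $k$ vertices, then $\mathcal{K}(\widetilde{G})>\mathcal{K}(\widehat{G})$.
   Context: Graphs are finite, simple and undirected. Attaching $k$ pendent vertices to $v$ means adding $k$ new vertices, each adjacent only to $v$. For a connected graph $G$ with at least one edge, the random walk on $G$ has transition matrix $D^{-1}A$ ($A$ adjacency matrix, $D$ diagonal degree matrix), with stationary distribution $w_i=\deg(v_i)/(2|E(G)|)$ and mean first passage times $m_{i,j}$ ($i\neq j$; expected number of steps to first reach $v_j$ from $v_i$). Kemeny's constant is $\mathcal{K}(G)=\sum_{j\neq i} w_j m_{i,j}$, which is independent of $i$; equivalently $\mathcal{K}(G)=\sum_{j\ge2}\frac{1}{1-\lambda_j}$ over the eigenvalues of $D^{-1}A$ other than the simple eigenvalue $\lambda_1=1$. *)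

theory Defs
  imports "HOL-Probability.Probability" "Graph_Theory.Graph_Theory"
begin

text \<open>
  A finite simple undirected graph is a \<open>pair_graph\<close>: a finite loop-free digraph, given by a set of
  vertices and a set of ordered pairs, whose arc relation is symmetric.  An edge between \<open>u\<close> and
  \<open>w\<close> is thus represented by the two arcs \<open>(u, w)\<close> and \<open>(w, u)\<close>, and the degree of a vertex is its
  out-degree.
\<close>

definition uedges :: "'a pair_pre_digraph \<Rightarrow> 'a set set" where
  "uedges G = {{u, w} | u w. (u, w) \<in> parcs G}"

definition independent_set :: "'a pair_pre_digraph \<Rightarrow> 'a set \<Rightarrow> bool" where
  "independent_set G S \<longleftrightarrow> S \<subseteq> pverts G \<and> (\<forall>x\<in>S. \<forall>y\<in>S. (x, y) \<notin> parcs G)"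

text \<open>\<open>P\<close> is the set of attached vertices, to be chosen disjoint from the vertices of \<open>G\<close>.\<close>
definition attach_pendents :: "'a pair_pre_digraph \<Rightarrow> 'a \<Rightarrow> 'a set \<Rightarrow> 'a pair_pre_digraph" where
  "attach_pendents G v P =
     \<lparr> pverts = pverts G \<union> P, parcs = parcs G \<union> ({v} \<times> P) \<union> (P \<times> {v}) \<rparr>"

definition add_clique :: "'a pair_pre_digraph \<Rightarrow> 'a set \<Rightarrow> 'a pair_pre_digraph" where
  "add_clique G S =
     \<lparr> pverts = pverts G, parcs = parcs G \<union> {(x, y). x \<in> S \<and> y \<in> S \<and> x \<noteq> y} \<rparr>"

text \<open>
  One step of the random walk, i.e. the row of \<open>D\<^sup>-\<^sup>1A\<close> belonging to \<open>u\<close>: uniform on the neighbours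
  of \<open>u\<close>.  This is meaningful only if \<open>u\<close> has finitely many neighbours and at least one.
\<close>
definition rw_step :: "'a pair_pre_digraph \<Rightarrow> 'a \<Rightarrow> 'a pmf" where
  "rw_step G u = pmf_of_set {w. (u, w) \<in> parcs G}"

text \<open>The joint law of the first \<open>n + 1\<close> positions \<open>[X\<^sub>0, \<dots>, X\<^sub>n]\<close> of the walk started at \<open>X\<^sub>0 = u\<close>.\<close>
primrec rw_trajectory :: "'a pair_pre_digraph \<Rightarrow> nat \<Rightarrow> 'a \<Rightarrow> 'a list pmf" where
  "rw_trajectory G 0 u = return_pmf [u]"
| "rw_trajectory G (Suc n) u =
     bind_pmf (rw_step G u) (\<lambda>w. map_pmf (\<lambda>xs. u # xs) (rw_trajectory G n w))"

text \<open>The probability that the walk started at \<open>i\<close> visits \<open>j\<close> for the first time at step \<open>n\<close>.\<close>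
definition first_passage_prob :: "'a pair_pre_digraph \<Rightarrow> 'a \<Rightarrow> 'a \<Rightarrow> nat \<Rightarrow> real" where
  "first_passage_prob G i j n =
     measure_pmf.prob (rw_trajectory G n i) {xs. xs ! n = j \<and> (\<forall>t<n. xs ! t \<noteq> j)}"

text \<open>
  The expectation of the first passage time, for \<open>i \<noteq> j\<close>.  On a finite connected graph \<open>j\<close> is
  reached almost surely and the series converges.
\<close>
definition mean_first_passage :: "'a pair_pre_digraph \<Rightarrow> 'a \<Rightarrow> 'a \<Rightarrow> real" where
  "mean_first_passage G i j = (\<Sum>n. real n * first_passage_prob G i j n)"

definition rw_stationary :: "'a pair_pre_digraph \<Rightarrow> 'a \<Rightarrow> real" where
  "rw_stationary G j = real (out_degree (with_proj G) j) / (2 * real (card (uedges G)))"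

text \<open>The value of the sum that is common to all starting vertices \<open>i\<close>.\<close>
definition kemeny :: "'a pair_pre_digraph \<Rightarrow> real" where
  "kemeny G = (THE c. \<forall>i\<in>pverts G.
     (\<Sum>j\<in>pverts G - {i}. rw_stationary G j * mean_first_passage G i j) = c)"

definition braess_clique :: "'a pair_pre_digraph \<Rightarrow> 'a set \<Rightarrow> bool" where
  "braess_clique G S \<longleftrightarrow> independent_set G S \<and> kemeny (add_clique G S) > kemeny G"

end

theory Submission
  imports Defs
begin

text \<open>
  The passage times to \<open>j\<close> are the unique function \<open>h\<close> with \<open>h j = 0\<close> and \<open>L h = deg\<close> away from \<open>j\<close>,
  where \<open>L\<close> is the graph Laplacian. If two graphs with \<open>a\<close> and \<open>b\<close> arcs are glued at a vertex \<open>v\<close>, this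
  characterisation expresses the passage times of the union in terms of those of the parts, and
  evaluating Kemeny's constant from \<open>v\<close> gives
  \<open>A\<^sub>1/a + A\<^sub>2/b + (b/a S\<^sub>1 + a/b S\<^sub>2)/(a + b)\<close>, where \<open>A\<^sub>i\<close> and \<open>S\<^sub>i\<close> are the degree-weighted sums of the passage
  times from and to \<open>v\<close> in the parts. Both graphs of the theorem are \<open>G\<close> glued at \<open>v\<close> to an explicit
  graph, a star or a complete graph on \<open>k + 1\<close> vertices. Their difference increases with \<open>S\<^sub>1\<close>; since
  \<open>S\<^sub>1 \<ge> m\<close>, it is at least a positive multiple of \<open>(4m - (k + 1)) (m + k)\<close>.
\<close>

section \<open>Graph Laplacian and hitting functions\<close>

definition nbhd :: "'a pair_pre_digraph \<Rightarrow> 'a \<Rightarrow> 'a set" where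
  "nbhd G x = {y. (x, y) \<in> parcs G}"

definition deg :: "'a pair_pre_digraph \<Rightarrow> 'a \<Rightarrow> real" where
  "deg G x = real (card (nbhd G x))"

definition laplacian :: "'a pair_pre_digraph \<Rightarrow> ('a \<Rightarrow> real) \<Rightarrow> 'a \<Rightarrow> real" where
  "laplacian G g x = (\<Sum>y\<in>nbhd G x. g x - g y)"

definition hitting :: "'a pair_pre_digraph \<Rightarrow> 'a \<Rightarrow> ('a \<Rightarrow> real) \<Rightarrow> bool" where
  "hitting G j h \<longleftrightarrow> h j = 0 \<and> (\<forall>x\<in>pverts G - {j}. laplacian G h x = deg G x)"

text \<open>The target comes first, so that \<open>passage_time G j\<close> is a function of the starting vertex.\<close>
definition passage_time :: "'a pair_pre_digraph \<Rightarrow> 'a \<Rightarrow> 'a \<Rightarrow> real" where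
  "passage_time G j x = (if x = j then 0 else mean_first_passage G x j)"

lemma laplacian_diff: "laplacian G (\<lambda>x. g x - h x) x = laplacian G g x - laplacian G h x"
  by (simp add: laplacian_def algebra_simps flip: sum_subtractf)

lemma laplacian_add: "laplacian G (\<lambda>x. g x + h x) x = laplacian G g x + laplacian G h x"
  by (simp add: laplacian_def algebra_simps flip: sum.distrib)

lemma laplacian_cmult: "laplacian G (\<lambda>x. c * g x) x = c * laplacian G g x"
  by (simp add: laplacian_def sum_distrib_left right_diff_distrib)

lemma laplacian_const: "laplacian G (\<lambda>x. c) x = 0"
  by (simp add: laplacian_def)

lemma laplacian_sum: "laplacian G (\<lambda>x. \<Sum>j\<in>A. g j x) x = (\<Sum>j\<in>A. laplacian G (g j) x)"
  by (simp add: laplacian_def sum_subtractf[symmetric] sum.swap[of _ A])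

lemma laplacian_eq: "laplacian G g x = deg G x * g x - (\<Sum>y\<in>nbhd G x. g y)"
  by (simp add: laplacian_def deg_def sum_subtractf)

section \<open>First-step analysis of first passage probabilities\<close>

lemma first_passage_prob_0: "first_passage_prob G i j 0 = (if i = j then 1 else 0)"
  by (simp add: first_passage_prob_def)

text \<open>Condition on the first step: prefixing \<open>i\<close> to a trajectory delays a first
  passage by one step, or rules it out if \<open>i = j\<close>. The hypotheses on
  \<open>nbhd G i\<close> are what makes \<open>pmf_of_set\<close> the uniform law.\<close>

lemma first_passage_prob_Suc:
  assumes "finite (nbhd G i)" "nbhd G i \<noteq> {}"
  shows "first_passage_prob G i j (Suc n) =
    (if i = j then 0 else (\<Sum>w\<in>nbhd G i. first_passage_prob G w j n) / deg G i)"
proof -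
  let ?A = "{xs. xs ! Suc n = j \<and> (\<forall>t<Suc n. xs ! t \<noteq> j)}"
  have vimage: "(\<lambda>xs. i # xs) -` ?A = (if i = j then {} else {xs. xs ! n = j \<and> (\<forall>t<n. xs ! t \<noteq> j)})"
    by (auto simp: less_Suc_eq_0_disj)
  have "first_passage_prob G i j (Suc n) =
      (\<integral>w. measure_pmf.prob (rw_trajectory G n w) ((\<lambda>xs. i # xs) -` ?A) \<partial>rw_step G i)"
    unfolding first_passage_prob_def rw_trajectory.simps measure_pmf_bind
    by (subst measure_pmf.measure_bind[where N = "count_space UNIV"])
      (auto simp: space_subprob_algebra intro!: subprob_space_measure_pmf)
  also have "\<dots> = (\<Sum>w\<in>nbhd G i. measure_pmf.prob (rw_trajectory G n w) ((\<lambda>xs. i # xs) -` ?A)) / deg G i"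
    using assms by (simp add: rw_step_def integral_pmf_of_set nbhd_def deg_def)
  also have "\<dots> = (if i = j then 0 else (\<Sum>w\<in>nbhd G i. first_passage_prob G w j n) / deg G i)"
    unfolding vimage by (simp add: first_passage_prob_def)
  finally show ?thesis .
qed

lemma first_passage_prob_nonneg: "first_passage_prob G i j n \<ge> 0"
  by (simp add: first_passage_prob_def)

section \<open>Double counting and Dirichlet energy on a connected graph\<close>

locale connected_graph = pair_graph G for G :: "'a pair_pre_digraph" +
  assumes reach: "\<lbrakk>x \<in> pverts G; y \<in> pverts G\<rbrakk> \<Longrightarrow> (x, y) \<in> (parcs G)\<^sup>*"
    and parcs_nonempty: "parcs G \<noteq> {}"
begin

lemma finite_nbhd: "finite (nbhd G x)"
  by (rule finite_subset[OF _ pair_finite_verts]) (auto simp: nbhd_def dest: in_arcsD2)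

lemma nbhd_subset: "nbhd G x \<subseteq> pverts G"
  by (auto simp: nbhd_def dest: in_arcsD2)

lemma nbhd_sym: "y \<in> nbhd G x \<longleftrightarrow> x \<in> nbhd G y"
  by (auto simp: nbhd_def intro: arcs_symmetric)

lemma nbhd_irrefl: "x \<notin> nbhd G x"
  by (auto simp: nbhd_def dest: no_loops')

text \<open>A path from \<open>x\<close> to an endpoint of some arc has to leave \<open>x\<close>.
  Hence \<open>rw_step\<close> never draws from an empty set.\<close>

lemma nbhd_nonempty:
  assumes "x \<in> pverts G" shows "nbhd G x \<noteq> {}"
proof -
  obtain a b where ab: "(a, b) \<in> parcs G" using parcs_nonempty by auto
  show ?thesis
  proof (cases "x = a")
    case True
    with ab show ?thesis by (auto simp: nbhd_def)
  next
    case False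
    with reach[OF assms in_arcsD1[OF ab]] show ?thesis
      by (auto elim: converse_rtranclE simp: nbhd_def)
  qed
qed

lemma deg_ge_1: "x \<in> pverts G \<Longrightarrow> deg G x \<ge> 1"
  using nbhd_nonempty[of x] finite_nbhd[of x] by (simp add: deg_def Suc_le_eq card_gt_0_iff)

text \<open>Both sides sum over all arcs, and reversal permutes the arcs. This is the form in which
  reversibility of the walk is used.\<close>

lemma sum_nbhd_swap:
  "(\<Sum>x\<in>pverts G. \<Sum>y\<in>nbhd G x. f x y) = (\<Sum>x\<in>pverts G. \<Sum>y\<in>nbhd G x. f y x)"
proof -
  have "(\<Sum>x\<in>pverts G. \<Sum>y\<in>nbhd G x. f x y) = (\<Sum>x\<in>pverts G. \<Sum>y\<in>{y\<in>pverts G. y \<in> nbhd G x}. f x y)"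
    using nbhd_subset by (intro sum.cong) auto
  also have "\<dots> = (\<Sum>y\<in>pverts G. \<Sum>x\<in>{x\<in>pverts G. y \<in> nbhd G x}. f x y)"
    by (rule sum.swap_restrict) (auto simp: pair_finite_verts)
  also have "\<dots> = (\<Sum>y\<in>pverts G. \<Sum>x\<in>nbhd G y. f x y)"
    using nbhd_subset nbhd_sym by (intro sum.cong) auto
  finally show ?thesis .
qed

lemma sum_nbhd: "(\<Sum>x\<in>pverts G. \<Sum>y\<in>nbhd G x. g y) = (\<Sum>x\<in>pverts G. deg G x * g x)"
  by (subst sum_nbhd_swap) (simp add: deg_def)

lemma sum_laplacian: "(\<Sum>x\<in>pverts G. laplacian G g x) = 0"
  by (simp add: laplacian_eq sum_subtractf sum_nbhd)

lemma sum_deg: "(\<Sum>x\<in>pverts G. deg G x) = real (card (parcs G))"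
proof -
  have "parcs G = Sigma (pverts G) (nbhd G)"
    by (auto simp: nbhd_def dest: in_arcsD1)
  then show ?thesis
    by (simp add: deg_def card_SigmaI pair_finite_verts finite_nbhd)
qed

text \<open>Summation by parts turns the hypothesis into vanishing of the Dirichlet energy of \<open>g\<close>.\<close>
lemma const_if_energy_zero:
  assumes zero: "\<And>x. x \<in> pverts G \<Longrightarrow> g x * laplacian G g x = 0"
    and xy: "x \<in> pverts G" "y \<in> pverts G"
  shows "g x = g y"
proof -
  have "(\<Sum>x\<in>pverts G. \<Sum>y\<in>nbhd G x. (g x - g y)\<^sup>2) =
      (\<Sum>x\<in>pverts G. \<Sum>y\<in>nbhd G x. g x * (g x - g y)) +
      (\<Sum>x\<in>pverts G. \<Sum>y\<in>nbhd G x. g y * (g y - g x))"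
    unfolding sum.distrib[symmetric] by (intro sum.cong) (auto simp: power2_eq_square algebra_simps)
  \<comment> \<open>Reversing the arcs in the second double sum makes it equal to the first.\<close>
  also have "\<dots> = 2 * (\<Sum>x\<in>pverts G. g x * laplacian G g x)"
    by (subst (2) sum_nbhd_swap) (simp add: laplacian_def sum_distrib_left)
  also have "\<dots> = 0"
    using zero by (metis (no_types, lifting) mult_zero_right sum.neutral)
  finally have energy: "(\<Sum>x\<in>pverts G. \<Sum>y\<in>nbhd G x. (g x - g y)\<^sup>2) = 0" .
  have arc: "g a = g b" if "(a, b) \<in> parcs G" for a b
  proof -
    have "\<forall>x\<in>pverts G. (\<Sum>y\<in>nbhd G x. (g x - g y)\<^sup>2) = 0"
      using energy by (subst (asm) sum_nonneg_eq_0_iff) (auto intro: sum_nonneg simp: pair_finite_verts)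
    then have "(\<Sum>y\<in>nbhd G a. (g a - g y)\<^sup>2) = 0"
      using in_arcsD1[OF that] by blast
    then show ?thesis
      using that by (subst (asm) sum_nonneg_eq_0_iff) (auto simp: finite_nbhd, auto simp: nbhd_def)
  qed
  from reach[OF xy] show ?thesis
    by (induction rule: rtrancl_induct) (auto dest: arc)
qed

section \<open>Convergence of the passage series and the hitting equations\<close>

lemma first_passage_Suc:
  assumes "i \<in> pverts G" "i \<noteq> j"
  shows "first_passage_prob G i j (Suc n) = (\<Sum>w\<in>nbhd G i. first_passage_prob G w j n) / deg G i"
  using assms finite_nbhd nbhd_nonempty by (simp add: first_passage_prob_Suc)

lemma first_passage_self:
  assumes "j \<in> pverts G"
  shows "first_passage_prob G j j n = (if n = 0 then 1 else 0)"
  using assms finite_nbhd nbhd_nonempty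
  by (cases n) (simp_all add: first_passage_prob_Suc first_passage_prob_0)

text \<open>\<open>rw_trajectory G n\<close> is a separate law for each \<open>n\<close>, so the
  first passage events are not disjoint sets in one probability space. Induction with the first-step
  equation replaces that argument.\<close>

lemma first_passage_partial_le_1:
  assumes "i \<in> pverts G" "j \<in> pverts G"
  shows "(\<Sum>n<N. first_passage_prob G i j n) \<le> 1"
  using assms(1)
proof (induction N arbitrary: i)
  case (Suc N)
  show ?case
  proof (cases "i = j")
    case True
    then show ?thesis using assms(2) by (simp add: first_passage_self sum.delta)
  next
    case False
    have "(\<Sum>n<Suc N. first_passage_prob G i j n) =
        (\<Sum>w\<in>nbhd G i. \<Sum>n<N. first_passage_prob G w j n) / deg G i"
      using False Suc.prems
      by (simp add: sum.lessThan_Suc_shift first_passage_prob_0 first_passage_Suc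
          sum_divide_distrib[symmetric] sum.swap[of _ "nbhd G i"] del: sum.lessThan_Suc)
    also have "\<dots> \<le> (\<Sum>w\<in>nbhd G i. 1) / deg G i"
      using Suc.IH nbhd_subset by (intro divide_right_mono sum_mono) (auto simp: deg_def)
    also have "\<dots> \<le> 1"
      by (simp add: deg_def)
    finally show ?thesis .
  qed
qed simp

text \<open>After the index shift the weight is \<open>n + 1\<close>: the part \<open>n\<close>
  gives the truncated expectations at the neighbours, the part \<open>1\<close> their truncated
  passage probabilities.\<close>

lemma partial_expectation_Suc:
  fixes j :: 'a
  defines "S \<equiv> \<lambda>N i. \<Sum>n<N. real n * first_passage_prob G i j n"
  assumes "i \<in> pverts G" "i \<noteq> j"
  shows "deg G i * S (Suc N) i = (\<Sum>w\<in>nbhd G i. S N w + (\<Sum>n<N. first_passage_prob G w j n))"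
proof -
  have "S (Suc N) i = (\<Sum>n<N. (\<Sum>w\<in>nbhd G i. real n * first_passage_prob G w j n + first_passage_prob G w j n)) / deg G i"
    using assms(2,3) unfolding S_def
    by (simp add: sum.lessThan_Suc_shift first_passage_Suc sum_divide_distrib sum_distrib_left
        algebra_simps del: sum.lessThan_Suc flip: sum.distrib add_divide_distrib)
  moreover have "deg G i > 0"
    using deg_ge_1[OF assms(2)] by simp
  ultimately show ?thesis
    unfolding S_def by (simp add: sum.distrib sum.swap[of _ "nbhd G i"])
qed

text \<open>Weighting by degrees and using reversibility bounds the truncated expectations at the
  neighbours of \<open>j\<close>; the one-step equation then carries a bound from \<open>i\<close> to its neighbours.\<close>
lemma partial_expectation_bounded:
  assumes i: "i \<in> pverts G" and j: "j \<in> pverts G"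
  shows "\<exists>C. \<forall>N. (\<Sum>n<N. real n * first_passage_prob G i j n) \<le> C"
proof -
  define S where "S = (\<lambda>N i. \<Sum>n<N. real n * first_passage_prob G i j n)"
  define F where "F = (\<lambda>N i. \<Sum>n<N. first_passage_prob G i j n)"
  have S_nonneg: "S N x \<ge> 0" and F_nonneg: "F N x \<ge> 0" for N x
    by (auto simp: S_def F_def first_passage_prob_nonneg intro!: sum_nonneg)
  have S_self: "S N j = 0" for N
    using j by (auto simp: S_def first_passage_self intro!: sum.neutral)
  have S_mono: "S N x \<le> S (Suc N) x" for N x
    by (simp add: S_def first_passage_prob_nonneg)
  have F_le: "F N x \<le> 1" if "x \<in> pverts G" for N x
    using first_passage_partial_le_1[OF that j] by (simp add: F_def)
  have one_step: "deg G x * S (Suc N) x = (\<Sum>w\<in>nbhd G x. S N w + F N w)" if "x \<in> pverts G" "x \<noteq> j" for x N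
    using partial_expectation_Suc[OF that] by (simp add: S_def F_def)
  have near: "S N w \<le> real (card (parcs G))" if w: "w \<in> nbhd G j" for N w
  proof -
    have "S N w \<le> (\<Sum>w\<in>nbhd G j. S N w)"
      using w S_nonneg finite_nbhd by (intro member_le_sum) auto
    also have "\<dots> \<le> (\<Sum>w\<in>nbhd G j. S N w + F N w)"
      using F_nonneg by (intro sum_mono) auto
    \<comment> \<open>Only the row of \<open>j\<close> is wanted: the sum over all rows is evaluated
      by \<open>sum_nbhd\<close>, the remaining rows by \<open>one_step\<close>.\<close>
    also have "\<dots> = (\<Sum>x\<in>pverts G. \<Sum>w\<in>nbhd G x. S N w + F N w) - (\<Sum>x\<in>pverts G - {j}. \<Sum>w\<in>nbhd G x. S N w + F N w)"
      using j by (subst sum.remove[of "pverts G" j]) (auto simp: pair_finite_verts)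
    also have "\<dots> = (\<Sum>x\<in>pverts G. deg G x * (S N x + F N x)) - (\<Sum>x\<in>pverts G - {j}. deg G x * S (Suc N) x)"
      by (subst sum_nbhd) (simp add: one_step)
    also have "(\<Sum>x\<in>pverts G - {j}. deg G x * S (Suc N) x) = (\<Sum>x\<in>pverts G. deg G x * S (Suc N) x)"
      using j by (subst sum.remove[of "pverts G" j]) (auto simp: pair_finite_verts S_self)
    \<comment> \<open>As \<open>S\<close> grows with \<open>N\<close>, each vertex contributes at
      most its degree times \<open>F N x\<close>, and \<open>F N x \<le> 1\<close>.\<close>
    also have "(\<Sum>x\<in>pverts G. deg G x * (S N x + F N x)) - (\<Sum>x\<in>pverts G. deg G x * S (Suc N) x) \<le>
        (\<Sum>x\<in>pverts G. deg G x)"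
      unfolding sum_subtractf[symmetric]
    proof (rule sum_mono)
      fix x assume x: "x \<in> pverts G"
      have "deg G x * (S N x + F N x) - deg G x * S (Suc N) x = deg G x * (S N x + F N x - S (Suc N) x)"
        by (simp add: algebra_simps)
      also have "\<dots> \<le> deg G x * 1"
        using F_le[OF x, of N] S_mono[of N x] by (intro mult_left_mono) (auto simp: deg_def)
      finally show "deg G x * (S N x + F N x) - deg G x * S (Suc N) x \<le> deg G x" by simp
    qed
    finally show ?thesis by (simp add: sum_deg)
  qed
  from reach[OF j i] have "\<exists>C. \<forall>N. S N i \<le> C"
  proof (induction rule: rtrancl_induct)
    case base
    show ?case by (auto simp: S_self)
  next
    case (step y z)
    show ?case
    proof (cases "y = j")
      case True
      with step.hyps near show ?thesis by (auto simp: nbhd_def)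
    next
      case False
      have y: "y \<in> pverts G" using step.hyps in_arcsD1 by blast
      from step.IH obtain C where C: "\<And>N. S N y \<le> C" by blast
      have "S N z \<le> deg G y * C" for N
      proof -
        have "S N z \<le> S N z + F N z" using F_nonneg by simp
        also have "\<dots> \<le> (\<Sum>w\<in>nbhd G y. S N w + F N w)"
          using step.hyps S_nonneg F_nonneg finite_nbhd
          by (intro member_le_sum) (auto simp: nbhd_def)
        also have "\<dots> = deg G y * S (Suc N) y"
          using \<open>y \<noteq> j\<close> y by (simp add: one_step)
        also have "\<dots> \<le> deg G y * C"
          using C by (intro mult_left_mono) (auto simp: deg_def)
        finally show ?thesis .
      qed
      then show ?thesis by blast
    qed
  qed
  then show ?thesis by (simp add: S_def)
qed

lemma first_passage_summable:
  assumes "i \<in> pverts G" "j \<in> pverts G"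
  shows "summable (first_passage_prob G i j)"
  by (rule bounded_imp_summable[of _ 1])
    (use first_passage_partial_le_1[OF assms, of "Suc _"] in
      \<open>auto simp: first_passage_prob_nonneg lessThan_Suc_atMost\<close>)

lemma expectation_summable:
  assumes "i \<in> pverts G" "j \<in> pverts G"
  shows "summable (\<lambda>n. real n * first_passage_prob G i j n)"
proof -
  obtain C where "\<And>N. (\<Sum>n<N. real n * first_passage_prob G i j n) \<le> C"
    using partial_expectation_bounded[OF assms] by blast
  then have "(\<Sum>n\<le>N. real n * first_passage_prob G i j n) \<le> C" for N
    by (metis lessThan_Suc_atMost)
  then show ?thesis
    by (intro bounded_imp_summable[of _ C]) (simp_all add: first_passage_prob_nonneg)
qed

text \<open>Almost sure passage by uniqueness: the defect \<open>g\<close> vanishes at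
  \<open>j\<close> and is harmonic elsewhere, so its energy is zero and it is constant.\<close>

lemma first_passage_total:
  assumes i: "i \<in> pverts G" and j: "j \<in> pverts G"
  shows "(\<Sum>n. first_passage_prob G i j n) = 1"
proof -
  define g where "g = (\<lambda>x. (\<Sum>n. first_passage_prob G x j n) - 1)"
  have gj: "g j = 0"
    using suminf_finite[of "{0}" "first_passage_prob G j j"] by (simp add: g_def first_passage_self[OF j])
  have lap: "laplacian G g x = 0" if x: "x \<in> pverts G" "x \<noteq> j" for x
  proof -
    have "(\<Sum>n. first_passage_prob G x j n) = (\<Sum>n. first_passage_prob G x j (Suc n))"
      using suminf_split_head[OF first_passage_summable[OF x(1) j]] x by (simp add: first_passage_prob_0)
    also have "\<dots> = (\<Sum>n. (\<Sum>w\<in>nbhd G x. first_passage_prob G w j n) / deg G x)"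
      using x by (simp add: first_passage_Suc)
    also have "\<dots> = (\<Sum>w\<in>nbhd G x. \<Sum>n. first_passage_prob G w j n) / deg G x"
      using nbhd_subset j first_passage_summable
      by (subst suminf_divide) (auto intro!: summable_sum simp: suminf_sum subset_iff)
    finally have "g x + 1 = (\<Sum>w\<in>nbhd G x. g w + 1) / deg G x"
      by (simp add: g_def)
    then show ?thesis
      using deg_ge_1[OF x(1)] by (simp add: laplacian_eq sum.distrib field_simps) (simp add: deg_def)
  qed
  have "g i = g j"
    using lap gj i j by (intro const_if_energy_zero) (metis mult_zero_left mult_zero_right)
  then show ?thesis
    using gj by (simp add: g_def)
qed

text \<open>Shifting the series by one step turns the weight into \<open>n + 1\<close>. The
  additional terms have total probability 1 at each neighbour, which produces the right-hand side
  \<open>deg\<close>.\<close>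

lemma hitting_passage_time:
  assumes j: "j \<in> pverts G"
  shows "hitting G j (passage_time G j)"
proof -
  \<comment> \<open>This includes \<open>x = j\<close>, where the only nonzero probability is at
    \<open>n = 0\<close> and has weight 0.\<close>
  have pt: "passage_time G j x = (\<Sum>n. real n * first_passage_prob G x j n)" for x
    by (auto simp: passage_time_def mean_first_passage_def first_passage_self[OF j] suminf_finite[of "{}"])
  have "laplacian G (passage_time G j) x = deg G x" if x: "x \<in> pverts G" "x \<noteq> j" for x
  proof -
    define t where "t = (\<lambda>w n. real n * first_passage_prob G w j n + first_passage_prob G w j n)"
    have sums_t: "t w sums (passage_time G j w + 1)" if "w \<in> nbhd G x" for w
    proof -
      have w: "w \<in> pverts G" using that nbhd_subset by blast
      show ?thesis
        unfolding t_def pt first_passage_total[OF w j, symmetric]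
        by (intro sums_add summable_sums first_passage_summable expectation_summable w j)
    qed
    have summable_t: "summable (t w)" and suminf_t: "(\<Sum>n. t w n) = passage_time G j w + 1"
      if "w \<in> nbhd G x" for w
      using sums_t[OF that] by (simp_all add: sums_iff)
    have "passage_time G j x = (\<Sum>n. real (Suc n) * first_passage_prob G x j (Suc n))"
      using suminf_split_head[OF expectation_summable[OF x(1) j]] by (simp add: pt)
    also have "\<dots> = (\<Sum>n. (\<Sum>w\<in>nbhd G x. t w n) / deg G x)"
      using x by (simp add: t_def first_passage_Suc sum_distrib_left algebra_simps sum.distrib)
    also have "\<dots> = (\<Sum>w\<in>nbhd G x. \<Sum>n. t w n) / deg G x"
      by (simp add: suminf_divide suminf_sum summable_sum summable_t)
    also have "\<dots> = (\<Sum>w\<in>nbhd G x. passage_time G j w + 1) / deg G x"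
      by (simp add: suminf_t)
    finally show ?thesis
      using deg_ge_1[OF x(1)] by (simp add: laplacian_eq sum.distrib field_simps) (simp add: deg_def)
  qed
  then show ?thesis by (simp add: hitting_def passage_time_def)
qed

text \<open>Uniqueness for the hitting equations. Passage times in specific graphs are found by
  guessing a function and checking these equations.\<close>

lemma passage_time_eqI:
  assumes h: "hitting G j h" and j: "j \<in> pverts G" and x: "x \<in> pverts G"
  shows "passage_time G j x = h x"
proof -
  define g where "g = (\<lambda>x. passage_time G j x - h x)"
  have "g j = 0" "\<And>x. x \<in> pverts G - {j} \<Longrightarrow> laplacian G g x = 0"
    using h hitting_passage_time[OF j] unfolding g_def hitting_def laplacian_diff by auto
  then have "g x = g j"
    using x j by (intro const_if_energy_zero) (metis Diff_iff mult_zero_left mult_zero_right singletonD)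
  then show ?thesis
    using \<open>g j = 0\<close> by (simp add: g_def)
qed

text \<open>The value at the target follows from the others because the Laplacian sums to zero.\<close>
lemma laplacian_hitting_target:
  assumes h: "hitting G j h" and j: "j \<in> pverts G"
  shows "laplacian G h j = deg G j - real (card (parcs G))"
proof -
  have "0 = laplacian G h j + (\<Sum>x\<in>pverts G - {j}. laplacian G h x)"
    using sum_laplacian[of h] j by (simp add: sum.remove pair_finite_verts)
  also have "(\<Sum>x\<in>pverts G - {j}. laplacian G h x) = (\<Sum>x\<in>pverts G - {j}. deg G x)"
    using h by (simp add: hitting_def)
  also have "\<dots> = real (card (parcs G)) - deg G j"
    using sum_deg j by (simp add: sum.remove pair_finite_verts)
  finally show ?thesis by simp
qed

section \<open>Kemeny's constant in terms of passage times\<close>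

lemma card_parcs: "card (parcs G) = 2 * card (uedges G)"
proof -
  define f where "f = (\<lambda>a :: 'a \<times> 'a. {fst a, snd a})"
  have U: "f ` parcs G = uedges G"
    by (force simp: uedges_def f_def)
  have fibre: "card {a \<in> parcs G. f a = e} = 2" if "e \<in> f ` parcs G" for e
  proof -
    from that obtain a where a: "a \<in> parcs G" "e = f a" by blast
    obtain u w where uw: "a = (u, w)" by fastforce
    have "(w, u) \<in> parcs G" "u \<noteq> w"
      using a uw arcs_symmetric no_loops' by blast+
    moreover have "f b = f a \<longleftrightarrow> b = (u, w) \<or> b = (w, u)" for b
      by (cases b) (simp add: f_def uw doubleton_eq_iff)
    ultimately have "{b \<in> parcs G. f b = e} = {(u, w), (w, u)}"
      using a uw by auto
    then show ?thesis
      using \<open>u \<noteq> w\<close> by simp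
  qed
  have "card (parcs G) = (\<Sum>e\<in>f ` parcs G. card {a \<in> parcs G. f a = e})"
    using sum.group[of "parcs G" "f ` parcs G" f "\<lambda>_. 1::nat"] by (simp add: pair_finite_arcs)
  also have "\<dots> = 2 * card (f ` parcs G)"
    using fibre by simp
  finally show ?thesis by (simp only: U)
qed

lemma rw_stationary_eq: "rw_stationary G j = deg G j / real (card (parcs G))"
proof -
  have "out_arcs G j = (\<lambda>w. (j, w)) ` nbhd G j"
    by (auto simp: out_arcs_def nbhd_def)
  then have "out_degree G j = card (nbhd G j)"
    by (simp add: out_degree_def card_image inj_on_def)
  then show ?thesis
    by (simp add: rw_stationary_def deg_def card_parcs)
qed

text \<open>The weighted sum \<open>K\<close> of passage times is harmonic at every vertex, hence
  constant. This is the independence of the starting vertex, and it makes the description in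
  \<open>kemeny_def\<close> well defined.\<close>

lemma kemeny_eq:
  assumes v: "v \<in> pverts G"
  shows "kemeny G = (\<Sum>j\<in>pverts G - {v}. deg G j * passage_time G j v) / real (card (parcs G))"
proof -
  define K where "K = (\<lambda>x. \<Sum>j\<in>pverts G. deg G j * passage_time G j x)"
  have lap: "laplacian G K x = 0" if x: "x \<in> pverts G" for x
  proof -
    have "laplacian G K x = (\<Sum>j\<in>pverts G. deg G j * laplacian G (passage_time G j) x)"
      unfolding K_def laplacian_sum laplacian_cmult ..
    \<comment> \<open>The correction at the target \<open>j = x\<close> cancels the rest, because
      the degrees sum to \<open>card (parcs G)\<close>.\<close>
    also have "\<dots> = (\<Sum>j\<in>pverts G. deg G j * (deg G x - (if j = x then real (card (parcs G)) else 0)))"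
      using x hitting_passage_time by (intro sum.cong) (auto simp: laplacian_hitting_target hitting_def)
    also have "\<dots> = (\<Sum>j\<in>pverts G. deg G j * deg G x - (if j = x then deg G j * real (card (parcs G)) else 0))"
      by (intro sum.cong) (auto simp: algebra_simps)
    also have "\<dots> = 0"
      using x by (simp add: sum_subtractf sum.delta' sum.delta pair_finite_verts sum_distrib_right[symmetric] sum_deg)
    finally show ?thesis .
  qed
  have K: "K x = K v" if "x \<in> pverts G" for x
    using that v by (intro const_if_energy_zero) (simp_all add: lap)
  have drop: "(\<Sum>j\<in>pverts G - {i}. deg G j * passage_time G j i) = K i" if "i \<in> pverts G" for i
    unfolding K_def sum.remove[OF pair_finite_verts that] by (simp add: passage_time_def)
  have common: "(\<Sum>j\<in>pverts G - {i}. rw_stationary G j * mean_first_passage G i j) = K v / real (card (parcs G))"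
    if i: "i \<in> pverts G" for i
  proof -
    have "(\<Sum>j\<in>pverts G - {i}. rw_stationary G j * mean_first_passage G i j) =
        (\<Sum>j\<in>pverts G - {i}. deg G j * passage_time G j i) / real (card (parcs G))"
      unfolding sum_divide_distrib by (intro sum.cong) (auto simp: rw_stationary_eq passage_time_def)
    then show ?thesis using drop[OF i] K[OF i] by simp
  qed
  have "kemeny G = K v / real (card (parcs G))"
    unfolding kemeny_def by (rule the_equality) (use common v in auto)
  then show ?thesis using drop[OF v] by simp
qed

end


section \<open>Weighted sums of passage times from and to a vertex\<close>

definition outward_sum :: "'a pair_pre_digraph \<Rightarrow> 'a \<Rightarrow> real" where
  "outward_sum G v = (\<Sum>j\<in>pverts G - {v}. deg G j * passage_time G j v)"

text \<open>By \<open>kemeny_eq\<close>, \<open>outward_sum\<close> is \<open>card (parcs G)\<close>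
  times Kemeny's constant; this sum, with the direction of the walk reversed, may vary with
  \<open>v\<close>.\<close>

definition inward_sum :: "'a pair_pre_digraph \<Rightarrow> 'a \<Rightarrow> real" where
  "inward_sum G v = (\<Sum>j\<in>pverts G - {v}. deg G j * passage_time G v j)"

definition glue :: "'a pair_pre_digraph \<Rightarrow> 'a pair_pre_digraph \<Rightarrow> 'a pair_pre_digraph" where
  "glue G B = \<lparr> pverts = pverts G \<union> pverts B, parcs = parcs G \<union> parcs B \<rparr>"

lemma glue_commute: "glue G B = glue B G"
  by (simp add: glue_def Un_commute)

text \<open>Since the arcs are symmetric, reaching every vertex from one \<open>v\<close> is
  enough.\<close>

lemma connected_graphI:
  assumes "finite (pverts G)" "parcs G \<subseteq> pverts G \<times> pverts G" "sym (parcs G)" "irrefl (parcs G)"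
    and "parcs G \<noteq> {}" "v \<in> pverts G" "\<And>x. x \<in> pverts G \<Longrightarrow> (v, x) \<in> (parcs G)\<^sup>*"
  shows "connected_graph G"
proof -
  have "finite (parcs G)"
    using assms(1,2) finite_subset by blast
  moreover have "(x, y) \<in> (parcs G)\<^sup>*" if "x \<in> pverts G" "y \<in> pverts G" for x y
    using assms(7)[OF that(1)] assms(7)[OF that(2)] sym_rtrancl[OF assms(3)]
    by (meson rtrancl_trans symD)
  ultimately show ?thesis
    using assms(1-5) by unfold_locales (auto simp: symmetric_def irrefl_def)
qed

context connected_graph
begin

lemma passage_time_nonneg:
  assumes "x \<in> pverts G" "j \<in> pverts G"
  shows "passage_time G j x \<ge> 0"
  using suminf_nonneg[OF expectation_summable[OF assms]]
  by (simp add: passage_time_def mean_first_passage_def first_passage_prob_nonneg)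

lemma passage_time_ge_1:
  assumes x: "x \<in> pverts G" and j: "j \<in> pverts G" and "x \<noteq> j"
  shows "passage_time G j x \<ge> 1"
proof -
  have "deg G x * passage_time G j x - (\<Sum>y\<in>nbhd G x. passage_time G j y) = deg G x"
    using hitting_passage_time[OF j] x \<open>x \<noteq> j\<close> by (simp add: hitting_def laplacian_eq)
  moreover have "(\<Sum>y\<in>nbhd G x. passage_time G j y) \<ge> 0"
    using nbhd_subset j by (intro sum_nonneg passage_time_nonneg) auto
  ultimately have "deg G x * 1 \<le> deg G x * passage_time G j x"
    by simp
  then show ?thesis
    using deg_ge_1[OF x] by (subst (asm) mult_le_cancel_left_pos) auto
qed

text \<open>All passage times involved are at least 1, so it suffices that the degrees away from
  \<open>v\<close> sum to at least half of all degrees. They do: each neighbour of \<open>v\<close>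
  has degree at least 1, so their sum is at least \<open>deg G v\<close>.\<close>

lemma inward_sum_ge:
  assumes v: "v \<in> pverts G"
  shows "inward_sum G v \<ge> real (card (uedges G))"
proof -
  let ?s = "\<Sum>j\<in>pverts G - {v}. deg G j"
  have "deg G v = (\<Sum>j\<in>nbhd G v. 1)"
    by (simp add: deg_def)
  also have "\<dots> \<le> (\<Sum>j\<in>nbhd G v. deg G j)"
    using nbhd_subset by (intro sum_mono deg_ge_1) auto
  also have "\<dots> \<le> ?s"
    using nbhd_subset nbhd_irrefl by (intro sum_mono2) (auto simp: pair_finite_verts deg_def)
  finally have "deg G v \<le> ?s" .
  moreover have "deg G v + ?s = 2 * real (card (uedges G))"
    using sum_deg sum.remove[OF pair_finite_verts v, of "deg G"] by (simp add: card_parcs)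
  moreover have "?s \<le> inward_sum G v"
    unfolding inward_sum_def
  proof (rule sum_mono)
    fix j assume "j \<in> pverts G - {v}"
    then show "deg G j \<le> deg G j * passage_time G v j"
      using mult_left_mono[OF passage_time_ge_1[of j v], of "deg G j"] v by (simp add: deg_def)
  qed
  ultimately show ?thesis by simp
qed

lemma laplacian_cong:
  assumes "x \<in> pverts G" "\<And>y. y \<in> pverts G \<Longrightarrow> g y = h y"
  shows "laplacian G g x = laplacian G h x"
  using assms nbhd_subset unfolding laplacian_def by (intro sum.cong) auto

lemma nbhd_outside: "x \<notin> pverts G \<Longrightarrow> nbhd G x = {}"
  by (auto simp: nbhd_def dest: in_arcsD1)

end

section \<open>Graphs glued at one vertex\<close>

locale glued_graphs = connected_graph G + B: connected_graph B for G B :: "'a pair_pre_digraph" +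
  fixes v :: 'a
  assumes common_vertex: "pverts G \<inter> pverts B = {v}"
begin

lemma glued_graphs_commute: "glued_graphs B G v"
  using common_vertex by unfold_locales auto

lemma v_verts: "v \<in> pverts G" "v \<in> pverts B"
  using common_vertex by auto

lemma connected_graph_glue: "connected_graph (glue G B)"
proof (rule connected_graphI)
  show "finite (pverts (glue G B))"
    by (simp add: glue_def pair_finite_verts B.pair_finite_verts)
  show "parcs (glue G B) \<subseteq> pverts (glue G B) \<times> pverts (glue G B)"
    by (auto simp: glue_def dest: in_arcsD1 in_arcsD2 B.in_arcsD1 B.in_arcsD2)
  show "sym (parcs (glue G B))"
    by (auto simp: glue_def sym_def dest: arcs_symmetric B.arcs_symmetric)
  show "irrefl (parcs (glue G B))"
    by (auto simp: glue_def irrefl_def dest: no_loops' B.no_loops')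
  show "parcs (glue G B) \<noteq> {}"
    using parcs_nonempty by (simp add: glue_def)
  show "v \<in> pverts (glue G B)"
    using v_verts by (simp add: glue_def)
  show "(v, x) \<in> (parcs (glue G B))\<^sup>*" if "x \<in> pverts (glue G B)" for x
    using that reach[OF v_verts(1), of x] B.reach[OF v_verts(2), of x]
      rtrancl_mono[of "parcs G" "parcs G \<union> parcs B"] rtrancl_mono[of "parcs B" "parcs G \<union> parcs B"]
    by (auto simp: glue_def)
qed

lemma nbhd_glue: "nbhd (glue G B) x = nbhd G x \<union> nbhd B x"
  by (auto simp: nbhd_def glue_def)

text \<open>A common arc would have both ends at the only common vertex and so be a loop.\<close>

lemma nbhd_disjoint: "nbhd G x \<inter> nbhd B x = {}"
proof (rule ccontr)
  assume "nbhd G x \<inter> nbhd B x \<noteq> {}"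
  then obtain y where y: "(x, y) \<in> parcs G" "(x, y) \<in> parcs B"
    by (auto simp: nbhd_def)
  then have "x = v" "y = v"
    using common_vertex in_arcsD1 in_arcsD2 B.in_arcsD1 B.in_arcsD2 by blast+
  then show False using y no_loops' by blast
qed

lemma laplacian_glue: "laplacian (glue G B) g x = laplacian G g x + laplacian B g x"
  unfolding laplacian_def nbhd_glue
  by (rule sum.union_disjoint) (auto simp: finite_nbhd B.finite_nbhd nbhd_disjoint)

lemma deg_glue: "deg (glue G B) x = deg G x + deg B x"
  unfolding deg_def nbhd_glue
  by (simp add: card_Un_disjoint finite_nbhd B.finite_nbhd nbhd_disjoint)

lemma deg_glue_left: "x \<in> pverts G - {v} \<Longrightarrow> deg (glue G B) x = deg G x"
  using common_vertex B.nbhd_outside[of x] unfolding deg_glue by (fastforce simp: deg_def)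

lemma card_parcs_glue: "card (parcs (glue G B)) = card (parcs G) + card (parcs B)"
proof -
  have "parcs G \<inter> parcs B = {}"
    using nbhd_disjoint by (auto simp: nbhd_def)
  then show ?thesis
    by (simp add: glue_def card_Un_disjoint pair_finite_arcs B.pair_finite_arcs)
qed

text \<open>Seen from \<open>G\<close>, the excursions into \<open>B\<close> add a source \<open>|parcs B|\<close> at \<open>v\<close> to \<open>L h = deg\<close>.
  The response at \<open>x\<close> to a unit source at \<open>v\<close> with sink \<open>j\<close> is
  \<open>(m(x,j) + m(j,v) - m(x,v)) / |parcs G|\<close>; at \<open>x = v\<close> this is the effective resistance in terms of
  the commute time.\<close>
lemma passage_time_glue:
  assumes j: "j \<in> pverts G" "j \<noteq> v"
  defines "q \<equiv> real (card (parcs B)) / real (card (parcs G))"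
  shows "passage_time (glue G B) j v = (1 + q) * passage_time G j v + q * passage_time G v j"
proof -
  interpret H: connected_graph "glue G B" by (rule connected_graph_glue)
  \<comment> \<open>This is \<open>passage_time G j x\<close> plus \<open>card (parcs B)\<close>
    times the unit response described above.\<close>
  define f where "f = (\<lambda>x. (1 + q) * passage_time G j x + q * passage_time G v j - q * passage_time G v x)"
  \<comment> \<open>From a vertex outside \<open>G\<close> the walk must first return to
    \<open>v\<close>.\<close>
  define g where "g = (\<lambda>x. if x \<in> pverts G then f x else f v + passage_time B v x)"
  have hit_j: "hitting G j (passage_time G j)" and hit_v: "hitting G v (passage_time G v)"
    and hit_B: "hitting B v (passage_time B v)"
    using hitting_passage_time B.hitting_passage_time j v_verts by auto
  have q: "q * real (card (parcs G)) = real (card (parcs B))"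
    using parcs_nonempty pair_finite_arcs by (simp add: q_def card_eq_0_iff)
  have lapG: "laplacian G g x = deg G x + (if x = v then real (card (parcs B)) else 0)"
    if x: "x \<in> pverts G - {j}" for x
  proof -
    have "laplacian G g x = laplacian G f x"
      using x by (intro laplacian_cong) (auto simp: g_def)
    also have "\<dots> = (1 + q) * laplacian G (passage_time G j) x - q * laplacian G (passage_time G v) x"
      unfolding f_def laplacian_diff laplacian_add laplacian_cmult laplacian_const by simp
    also have "laplacian G (passage_time G j) x = deg G x"
      using hit_j x by (simp add: hitting_def)
    also have "laplacian G (passage_time G v) x = deg G x - (if x = v then real (card (parcs G)) else 0)"
      using laplacian_hitting_target[OF hit_v v_verts(1)] hit_v x by (auto simp: hitting_def)
    finally show ?thesis
      using q by (auto simp: algebra_simps)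
  qed
  \<comment> \<open>The deficit at \<open>v\<close> balances the source at \<open>v\<close> found in
    \<open>lapG\<close>.\<close>
  have lapB: "laplacian B g x = deg B x - (if x = v then real (card (parcs B)) else 0)"
    if x: "x \<in> pverts B" for x
  proof -
    have "laplacian B g x = laplacian B (\<lambda>x. f v + passage_time B v x) x"
    proof (rule B.laplacian_cong[OF x])
      fix y assume "y \<in> pverts B"
      then show "g y = f v + passage_time B v y"
        using common_vertex by (cases "y = v") (auto simp: g_def passage_time_def)
    qed
    also have "\<dots> = laplacian B (passage_time B v) x"
      unfolding laplacian_add laplacian_const by simp
    finally show ?thesis
      using B.laplacian_hitting_target[OF hit_B v_verts(2)] hit_B x by (auto simp: hitting_def)
  qed
  have "hitting (glue G B) j g"
    unfolding hitting_def
  proof (intro conjI ballI)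
    show "g j = 0"
      using j by (simp add: g_def f_def passage_time_def)
    fix x assume x: "x \<in> pverts (glue G B) - {j}"
    then consider "x = v" | "x \<in> pverts G - {j}" "x \<notin> pverts B" | "x \<in> pverts B" "x \<notin> pverts G"
      using common_vertex by (auto simp: glue_def)
    then show "laplacian (glue G B) g x = deg (glue G B) x"
    proof cases
      case 1
      then show ?thesis
        using lapG[of v] lapB[of v] v_verts j by (simp add: laplacian_glue deg_glue)
    next
      case 2
      then show ?thesis
        using lapG[of x] B.nbhd_outside[of x] v_verts
        by (auto simp: laplacian_glue deg_glue laplacian_def[of B] deg_def[of B])
    next
      case 3
      then show ?thesis
        using lapB[of x] nbhd_outside[of x] v_verts
        by (auto simp: laplacian_glue deg_glue laplacian_def[of G] deg_def[of G])
    qed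
  qed
  moreover have "j \<in> pverts (glue G B)" "v \<in> pverts (glue G B)"
    using j v_verts by (simp_all add: glue_def)
  ultimately have "passage_time (glue G B) j v = g v"
    by (rule H.passage_time_eqI)
  then show ?thesis
    using v_verts by (simp add: g_def f_def passage_time_def)
qed

lemma outward_sum_glue_left:
  defines "q \<equiv> real (card (parcs B)) / real (card (parcs G))"
  shows "(\<Sum>j\<in>pverts G - {v}. deg (glue G B) j * passage_time (glue G B) j v) =
    (1 + q) * outward_sum G v + q * inward_sum G v"
proof -
  have "(\<Sum>j\<in>pverts G - {v}. deg (glue G B) j * passage_time (glue G B) j v) =
      (\<Sum>j\<in>pverts G - {v}. (1 + q) * (deg G j * passage_time G j v) + q * (deg G j * passage_time G v j))"
    by (intro sum.cong) (auto simp: deg_glue_left passage_time_glue q_def algebra_simps)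
  then show ?thesis
    by (simp add: outward_sum_def inward_sum_def sum.distrib sum_distrib_left)
qed

lemma kemeny_glue:
  defines "a \<equiv> real (card (parcs G))" and "b \<equiv> real (card (parcs B))"
  shows "kemeny (glue G B) =
    outward_sum G v / a + outward_sum B v / b + (b / a * inward_sum G v + a / b * inward_sum B v) / (a + b)"
proof -
  interpret H: connected_graph "glue G B" by (rule connected_graph_glue)
  interpret R: glued_graphs B G v by (rule glued_graphs_commute)
  have pos: "a > 0" "b > 0"
    using parcs_nonempty pair_finite_arcs B.parcs_nonempty B.pair_finite_arcs
    by (auto simp: a_def b_def card_gt_0_iff)
  have "kemeny (glue G B) =
      (\<Sum>j\<in>pverts (glue G B) - {v}. deg (glue G B) j * passage_time (glue G B) j v) / (a + b)"
    using H.kemeny_eq[of v] v_verts by (simp add: card_parcs_glue a_def b_def) (simp add: glue_def)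
  also have "pverts (glue G B) - {v} = (pverts G - {v}) \<union> (pverts B - {v})"
    by (auto simp: glue_def)
  also have "(\<Sum>j\<in>(pverts G - {v}) \<union> (pverts B - {v}). deg (glue G B) j * passage_time (glue G B) j v) =
      ((1 + b / a) * outward_sum G v + b / a * inward_sum G v) +
      ((1 + a / b) * outward_sum B v + a / b * inward_sum B v)"
    using common_vertex
    by (subst sum.union_disjoint)
      (auto simp: pair_finite_verts B.pair_finite_verts outward_sum_glue_left
        R.outward_sum_glue_left[folded glue_commute[of G B]] a_def b_def)
  also have "\<dots> / (a + b) =
      outward_sum G v / a + outward_sum B v / b + (b / a * inward_sum G v + a / b * inward_sum B v) / (a + b)"
    \<comment> \<open>\<open>(1 + b / a) / (a + b) = 1 / a\<close>, so the outward sums no longer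
      involve the other part.\<close>
    using pos by (simp add: add_divide_distrib[symmetric]) (simp add: divide_simps, simp add: algebra_simps)
  finally show ?thesis .
qed

end

section \<open>Stars and complete graphs\<close>

definition star :: "'a \<Rightarrow> 'a set \<Rightarrow> 'a pair_pre_digraph" where
  "star v P = \<lparr> pverts = insert v P, parcs = {v} \<times> P \<union> P \<times> {v} \<rparr>"

definition complete_on :: "'a set \<Rightarrow> 'a pair_pre_digraph" where
  "complete_on V = \<lparr> pverts = V, parcs = {(x, y). x \<in> V \<and> y \<in> V \<and> x \<noteq> y} \<rparr>"

context
  fixes v :: 'a and P :: "'a set"
  assumes P: "finite P" "P \<noteq> {}" "v \<notin> P"
begin

lemma connected_graph_star: "connected_graph (star v P)"
  using P by (intro connected_graphI[of _ v]) (auto simp: star_def sym_def irrefl_def)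

lemma connected_graph_complete_on: "connected_graph (complete_on (insert v P))"
proof (rule connected_graphI[of _ v])
  show "parcs (complete_on (insert v P)) \<noteq> {}"
    using P by (auto simp: complete_on_def)
  show "(v, x) \<in> (parcs (complete_on (insert v P)))\<^sup>*" if "x \<in> pverts (complete_on (insert v P))" for x
    using that by (cases "x = v") (auto simp: complete_on_def)
qed (use P in \<open>auto simp: complete_on_def sym_def irrefl_def\<close>)

lemma nbhd_star: "nbhd (star v P) v = P" "x \<in> P \<Longrightarrow> nbhd (star v P) x = {v}"
  using P by (auto simp: nbhd_def star_def)

lemma nbhd_complete_on: "x \<in> insert v P \<Longrightarrow> nbhd (complete_on (insert v P)) x = insert v P - {x}"
  by (auto simp: nbhd_def complete_on_def)

lemma card_parcs_star: "card (parcs (star v P)) = 2 * card P"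
proof -
  have "({v} \<times> P) \<inter> (P \<times> {v}) = {}"
    using P by auto
  then show ?thesis
    using P by (simp add: star_def card_Un_disjoint card_cartesian_product)
qed

lemma card_parcs_complete_on: "card (parcs (complete_on (insert v P))) = card P * (card P + 1)"
proof -
  have "parcs (complete_on (insert v P)) = Sigma (insert v P) (\<lambda>x. insert v P - {x})"
    by (auto simp: complete_on_def)
  then show ?thesis
    using P by (simp add: card_SigmaI card_Diff_singleton_if)
qed

lemma passage_time_star:
  assumes j: "j \<in> P"
  shows "passage_time (star v P) j v = 2 * real (card P) - 1" "passage_time (star v P) v j = 1"
proof -
  interpret S: connected_graph "star v P" by (rule connected_graph_star)
  \<comment> \<open>With \<open>k = card P\<close>, a step from \<open>v\<close> hits
    \<open>j\<close> with probability \<open>1 / k\<close>. The expected \<open>k - 1\<close>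
    failures cost two steps each and the success one; another leaf needs one step more.\<close>
  let ?h = "\<lambda>x. if x = j then 0 else if x = v then 2 * real (card P) - 1 else 2 * real (card P)"
  have V: "j \<in> pverts (star v P)" "v \<in> pverts (star v P)"
    using j by (auto simp: star_def)
  have "(\<Sum>y\<in>P. ?h y) = (\<Sum>y\<in>P - {j}. 2 * real (card P))"
    unfolding sum.remove[OF P(1) j] using P(3)
    by (simp del: sum_constant cong: sum.cong_simp) (rule sum.cong, auto)
  also have "\<dots> = (real (card P) - 1) * (2 * real (card P))"
    using P j by (simp add: card_Diff_singleton of_nat_diff Suc_le_eq card_gt_0_iff)
  finally have "laplacian (star v P) ?h v = deg (star v P) v"
    using P j by (auto simp: laplacian_eq deg_def nbhd_star algebra_simps)
  moreover have "laplacian (star v P) ?h x = deg (star v P) x" if "x \<in> P" "x \<noteq> j" for x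
    unfolding laplacian_def deg_def nbhd_star(2)[OF that(1)] using that P j by auto
  ultimately have "hitting (star v P) j ?h"
    by (auto simp: hitting_def star_def[THEN arg_cong[of _ _ pverts]])
  then have "passage_time (star v P) j v = ?h v"
    using V by (rule S.passage_time_eqI)
  then show "passage_time (star v P) j v = 2 * real (card P) - 1"
    using P j by auto
  have "hitting (star v P) v (\<lambda>x. if x = v then 0 else 1)"
    using P unfolding hitting_def
    by (auto simp: laplacian_eq deg_def nbhd_star star_def[THEN arg_cong[of _ _ pverts]])
  then have "passage_time (star v P) v j = (if j = v then 0 else 1)"
    using V(2,1) by (rule S.passage_time_eqI)
  then show "passage_time (star v P) v j = 1"
    using P j by auto
qed

lemma passage_time_complete_on:
  assumes "i \<in> insert v P" "j \<in> insert v P" "i \<noteq> j"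
  shows "passage_time (complete_on (insert v P)) j i = real (card P)"
proof -
  interpret C: connected_graph "complete_on (insert v P)" by (rule connected_graph_complete_on)
  \<comment> \<open>Every step from another vertex hits \<open>j\<close> with probability
    \<open>1 / card P\<close>.\<close>
  let ?h = "\<lambda>x. if x = j then 0 else real (card P)"
  have "laplacian (complete_on (insert v P)) ?h x = deg (complete_on (insert v P)) x"
    if x: "x \<in> insert v P" "x \<noteq> j" for x
  proof -
    have "laplacian (complete_on (insert v P)) ?h x = (\<Sum>y\<in>insert v P - {x}. if y = j then real (card P) else 0)"
      unfolding laplacian_def nbhd_complete_on[OF x(1)] using x by (intro sum.cong) auto
    also have "\<dots> = real (card P)"
      using P assms(2) x by (subst sum.delta) auto
    finally show ?thesis
      unfolding deg_def nbhd_complete_on[OF x(1)] using P x by (simp add: card_Diff_singleton_if)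
  qed
  then have "hitting (complete_on (insert v P)) j ?h"
    by (simp add: hitting_def complete_on_def[THEN arg_cong[of _ _ pverts]])
  then have "passage_time (complete_on (insert v P)) j i = ?h i"
    using assms by (intro C.passage_time_eqI) (simp_all add: complete_on_def)
  then show ?thesis
    using assms by auto
qed

lemma star_sums:
  "outward_sum (star v P) v = real (card P) * (2 * real (card P) - 1)"
  "inward_sum (star v P) v = real (card P)"
proof -
  have V: "pverts (star v P) - {v} = P"
    using P by (auto simp: star_def)
  show "outward_sum (star v P) v = real (card P) * (2 * real (card P) - 1)"
    "inward_sum (star v P) v = real (card P)"
    unfolding outward_sum_def inward_sum_def V
    by (simp_all add: passage_time_star deg_def nbhd_star)
qed

lemma complete_on_sums:
  "outward_sum (complete_on (insert v P)) v = real (card P) ^ 3"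
  "inward_sum (complete_on (insert v P)) v = real (card P) ^ 3"
proof -
  have V: "pverts (complete_on (insert v P)) - {v} = P"
    using P by (auto simp: complete_on_def)
  have d: "deg (complete_on (insert v P)) j = real (card P)" if "j \<in> P" for j
    using that P by (simp add: deg_def nbhd_complete_on card_Diff_singleton_if)
  have p: "passage_time (complete_on (insert v P)) j v = real (card P)"
    "passage_time (complete_on (insert v P)) v j = real (card P)" if "j \<in> P" for j
    using that P by (auto intro!: passage_time_complete_on)
  show "outward_sum (complete_on (insert v P)) v = real (card P) ^ 3"
    "inward_sum (complete_on (insert v P)) v = real (card P) ^ 3"
    unfolding outward_sum_def inward_sum_def V by (simp_all add: d p power3_eq_cube)
qed

end

section \<open>Comparison of the two values\<close>

text \<open>The sides are \<open>kemeny_glue\<close> for the star and for the complete graph,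
  without the common summand \<open>outward_sum G v / a\<close>; \<open>s\<close> stands for
  \<open>inward_sum G v\<close>.\<close>

lemma kemeny_gap_pos:
  fixes k m s :: real
  assumes k: "k \<ge> 2" and m: "m > (k + 1) / 4" and s: "s \<ge> m"
  shows "k * (2 * k - 1) / (2 * k) + (2 * k / (2 * m) * s + 2 * m / (2 * k) * k) / (2 * m + 2 * k) <
    k ^ 3 / (k * (k + 1)) +
      (k * (k + 1) / (2 * m) * s + 2 * m / (k * (k + 1)) * k ^ 3) / (2 * m + k * (k + 1))"
    (is "?L < ?R")
proof -
  have pos: "m > 0" "k > 0" using k m by auto
  \<comment> \<open>This product is the value at \<open>s = m\<close> of the factor of
    \<open>?R - ?L\<close> that is linear in \<open>s\<close>.\<close>
  have "0 < (4 * m - (k + 1)) * (m + k)"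
    using m k pos by (intro mult_pos_pos) auto
  also have "\<dots> = (k + 1) * m + (4 * m\<^sup>2 + 2 * m * (k - 1) - k * (k + 1))"
    by (simp add: algebra_simps power2_eq_square)
  also have "\<dots> \<le> (k + 1) * s + (4 * m\<^sup>2 + 2 * m * (k - 1) - k * (k + 1))"
    using s k by (intro add_right_mono mult_left_mono) auto
  finally have num: "0 < (k + 1) * s + (4 * m\<^sup>2 + 2 * m * (k - 1) - k * (k + 1))" .
  define a where "a = 2 * m + 2 * k"
  define b where "b = 2 * m + k * (k + 1)"
  have ab: "a > 0" "b > 0" using pos by (auto simp: a_def b_def add_pos_pos)
  have L: "?L = ((2 * k - 1) / 2 * a + k * s / m + m) / a"
    unfolding a_def[symmetric] using pos ab by (simp add: add_divide_distrib)
  have R: "?R = (k\<^sup>2 / (k + 1) * b + k * (k + 1) * s / (2 * m) + 2 * m * k\<^sup>2 / (k + 1)) / b"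
    unfolding b_def[symmetric] using pos ab
    by (simp add: add_divide_distrib power2_eq_square power3_eq_cube)
  have "?R - ?L = k * (k - 1) * ((k + 1) * s + (4 * m\<^sup>2 + 2 * m * (k - 1) - k * (k + 1))) / ((k + 1) * a * b)"
  proof -
    have "?R - ?L = ((k\<^sup>2 / (k + 1) * b + k * (k + 1) * s / (2 * m) + 2 * m * k\<^sup>2 / (k + 1)) * a -
        ((2 * k - 1) / 2 * a + k * s / m + m) * b) / (a * b)"
      unfolding L R using ab by (simp add: field_simps)
    also have "\<dots> = k * (k - 1) * ((k + 1) * s + (4 * m\<^sup>2 + 2 * m * (k - 1) - k * (k + 1))) / (k + 1) / (a * b)"
    proof (rule arg_cong[where f = "\<lambda>x. x / (a * b)"])
      \<comment> \<open>Naming the quotients leaves a polynomial identity modulo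
        \<open>u * (k + 1) = 1\<close>, \<open>2 * m * w = s\<close> and
        \<open>2 * h = 2 * k - 1\<close>, which \<open>algebra\<close> can decide.\<close>
      define u where "u = 1 / (k + 1)"
      define w where "w = s / (2 * m)"
      define h where "h = (2 * k - 1) / 2"
      have u: "u * (k + 1) = 1" and w: "2 * m * w = s"
        using pos by (auto simp: u_def w_def)
      have "2 * h = 2 * k - 1"
        by (simp add: h_def)
      then have "(k\<^sup>2 * u * b + k * (k + 1) * w + 2 * m * k\<^sup>2 * u) * a - (h * a + 2 * k * w + m) * b =
        k * (k - 1) * ((k + 1) * s + (4 * m\<^sup>2 + 2 * m * (k - 1) - k * (k + 1))) * u"
        unfolding a_def b_def using u w by algebra
      moreover have "x / (k + 1) = x * u" for x
        by (simp add: u_def)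
      moreover have "k * (k + 1) * s / (2 * m) = k * (k + 1) * w" "k * s / m = 2 * k * w"
        by (simp_all add: w_def)
      ultimately show "(k\<^sup>2 / (k + 1) * b + k * (k + 1) * s / (2 * m) + 2 * m * k\<^sup>2 / (k + 1)) * a -
          ((2 * k - 1) / 2 * a + k * s / m + m) * b =
        k * (k - 1) * ((k + 1) * s + (4 * m\<^sup>2 + 2 * m * (k - 1) - k * (k + 1))) / (k + 1)"
        by (simp only: h_def)
    qed
    finally show ?thesis by (simp add: mult.assoc)
  qed
  moreover have "\<dots> > 0"
    using num k pos ab by (intro divide_pos_pos mult_pos_pos) auto
  ultimately show ?thesis by simp
qed

section \<open>Both graphs as gluings of \<open>G\<close> with an explicit graph\<close>

theorem corollary4p5:
  fixes G :: "'a pair_pre_digraph" and v :: 'a and P :: "'a set" and k m :: nat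
  assumes "pair_graph G"
    and "Digraph_Component.connected (with_proj G)"
    and "card (uedges G) = m"
    and "v \<in> pverts G"
    and "k \<ge> 2"
    and "P \<inter> pverts G = {}"
    and "card P = k"
    and "real m > (real k + 1) / 4"
  shows "braess_clique (attach_pendents G v P) P"
proof -
  interpret pair_graph G by fact
  \<comment> \<open>Infinite sets have cardinality 0, so \<open>k \<ge> 2\<close> forces
    \<open>P\<close> to be finite.\<close>
  have P: "finite P" "P \<noteq> {}" "v \<notin> P"
    using assms card.infinite[of P] by auto
  \<comment> \<open>The lower bound on \<open>m\<close> makes it positive.\<close>
  have "uedges G \<noteq> {}"
    using assms by auto
  then have "parcs G \<noteq> {}"
    by (auto simp: uedges_def)
  moreover have "strongly_connected (with_proj G)"
    using assms(2) sym_arcs by (rule symmetric_connected_imp_strongly_connected[rotated])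
  ultimately have G: "connected_graph G"
    by unfold_locales (auto simp: strongly_connected_def reachable_conv)
  interpret G: connected_graph G by (rule G)
  interpret star: connected_graph "star v P" by (rule connected_graph_star[OF P])
  interpret clique: connected_graph "complete_on (insert v P)" by (rule connected_graph_complete_on[OF P])
  interpret S: glued_graphs G "star v P" v
    using assms by unfold_locales (auto simp: star_def)
  interpret C: glued_graphs G "complete_on (insert v P)" v
    using assms by unfold_locales (auto simp: complete_on_def)
  have S: "attach_pendents G v P = glue G (star v P)"
    using assms(4) by (auto simp: attach_pendents_def glue_def star_def)
  have C: "add_clique (attach_pendents G v P) P = glue G (complete_on (insert v P))"
    using assms(4) P by (auto simp: add_clique_def attach_pendents_def glue_def complete_on_def)
  have "independent_set (attach_pendents G v P) P"
    using assms(6) P by (auto simp: independent_set_def attach_pendents_def dest: in_arcsD1)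
  moreover have "kemeny (glue G (star v P)) < kemeny (glue G (complete_on (insert v P)))"
    unfolding S.kemeny_glue C.kemeny_glue star_sums[OF P] complete_on_sums[OF P] G.card_parcs
      card_parcs_star[OF P] card_parcs_complete_on[OF P] assms(3,7)
    using kemeny_gap_pos[of "real k" "real m" "inward_sum G v"] G.inward_sum_ge[OF assms(4)] assms
    by (simp add: algebra_simps)
  ultimately show ?thesis
    unfolding braess_clique_def C unfolding S by simp
qed

end
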